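(* Let $A\in\mathbb{R}^{m\times n}$ be a nonzero matrix all of whose nonzero singular values are equal, i.e. $\sigma_1(A)=\sigma_{\min}(A)$, and let $b\in\mathbb{R}^m$ be arbitrary. Let $\{x^k\}_{k=0}^{\infty}$ be the random sequence generated by the randomized Kaczmarz method with adaptive stepsizes (RKAS) applied to $Ax=b$ with $x^0=0$. Then for every $k\ge 0$ both of the following equalities hold: $$\mathbb{E}\left[\left\|Ax^k-AA^\dagger b\right\|^2_2\right]= \left(1-\frac{\sigma_{\min}^4(A)}{\|A\|_2^2\,\|A\|_F^2}\right)^k\left\|Ax^0-AA^\dagger b\right\|^2_2,$$ $$\mathbb{E}\left[\left\|x^k-A^\dagger b\right\|^2_2\right]= \sigma_{\min}^{-2}(A)\left(1-\frac{\sigma_{\min}^4(A)}{\|A\|_2^2\,\|A\|_F^2}\right)^k\left\|Ax^0-AA^\dagger b\right\|^2_2.$$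
   Context: Notation: $A_{i,:}$ is the $i$-th row of $A$ (a row vector), $A^\top$ the transpose, $A^\dagger$ the Moore-Penrose pseudoinverse, $\|A\|_2$ the spectral norm, $\|A\|_F$ the Frobenius norm, $\sigma_1(A)=\|A\|_2$ the largest singular value, $\sigma_{\min}(A)>0$ the smallest nonzero singular value of $A$, and $\|\cdot\|_2$ and $\langle\cdot,\cdot\rangle$ the Euclidean norm and inner product on vectors. RKAS algorithm: start with $x^0=0\in\mathbb{R}^n$ and $r^0=Ax^0-b=-b$. For $k=0,1,2,\dots$: (1) select a random index $i_k\in\{1,\dots,m\}$, independently of the previous selections, with $\Pr(i_k=i)=\|A_{i,:}\|_2^2/\|A\|_F^2$ (so zero rows are selected with probability zero); (2) compute $\alpha_k=\dfrac{\langle AA_{i_k,:}^\top,\,r^k\rangle}{\|AA_{i_k,:}^\top\|_2^2}$; (3) update $x^{k+1}=x^k-\alpha_kA_{i_k,:}^\top$ and $r^{k+1}=r^k-\alpha_kAA_{i_k,:}^\top$. The algorithm is run without a stopping rule, and the expectation is over the random choices $i_0,i_1,\dots$. If $k=0$ and the base of the power is $0$, the convention $0^0=1$ is used. *)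

theory Defs
  imports "HOL-Probability.Probability"
begin

text \<open>The square roots of the eigenvalues of \<open>A\<^sup>T A\<close>, as a set.  Multiplicities, and whether 0 is
  listed, depend on the convention chosen for singular values, but not the two quantities below
  when \<open>A \<noteq> 0\<close>.\<close>
definition singular_values :: "real^'n^'m \<Rightarrow> real set" where
  "singular_values A =
     {sqrt l | l. \<exists>v. v \<noteq> 0 \<and> (transpose A ** A) *v v = l *\<^sub>R v}"

definition sigma_max :: "real^'n^'m \<Rightarrow> real" where
  "sigma_max A = Max (singular_values A)"

definition sigma_min :: "real^'n^'m \<Rightarrow> real" where
  "sigma_min A = Min (singular_values A - {0})"

definition spectral_norm :: "real^'n^'m \<Rightarrow> real" where
  "spectral_norm A = onorm ((*v) A)"

definition frobenius_norm :: "real^'n^'m \<Rightarrow> real" where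
  "frobenius_norm A = sqrt (\<Sum>i\<in>UNIV. \<Sum>j\<in>UNIV. (A $ i $ j)\<^sup>2)"

definition is_pinv :: "real^'n^'m \<Rightarrow> real^'m^'n \<Rightarrow> bool" where
  "is_pinv A P \<longleftrightarrow>
     A ** P ** A = A \<and> P ** A ** P = P \<and>
     transpose (A ** P) = A ** P \<and> transpose (P ** A) = P ** A"

definition pinv :: "real^'n^'m \<Rightarrow> real^'m^'n" where
  "pinv A = (THE P. is_pinv A P)"

definition rkas_alpha :: "real^'n^'m \<Rightarrow> 'm \<Rightarrow> real^'m \<Rightarrow> real" where
  "rkas_alpha A i r = ((A *v row i A) \<bullet> r) / (norm (A *v row i A))\<^sup>2"

text \<open>The pair \<open>(x\<^sup>k, r\<^sup>k)\<close> produced from the starting point \<open>x0\<close> when the selected row indices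
  are \<open>s 0, s 1, \<dots>\<close>.  The denominator of the stepsize vanishes only for a zero row, which is
  selected with probability 0; by \<open>x / 0 = 0\<close> such a step changes nothing.\<close>
primrec rkas :: "real^'n^'m \<Rightarrow> real^'m \<Rightarrow> real^'n \<Rightarrow> (nat \<Rightarrow> 'm) \<Rightarrow> nat \<Rightarrow> (real^'n) \<times> (real^'m)"
  where
  "rkas A b x0 s 0 = (x0, A *v x0 - b)"
| "rkas A b x0 s (Suc k) =
     (let (x, r) = rkas A b x0 s k; \<alpha> = rkas_alpha A (s k) r
      in (x - \<alpha> *\<^sub>R row (s k) A, r - \<alpha> *\<^sub>R (A *v row (s k) A)))"

definition rkas_x :: "real^'n^'m \<Rightarrow> real^'m \<Rightarrow> real^'n \<Rightarrow> (nat \<Rightarrow> 'm) \<Rightarrow> nat \<Rightarrow> real^'n" where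
  "rkas_x A b x0 s k = fst (rkas A b x0 s k)"

text \<open>\<open>I k\<close> is the random row index selected in step \<open>k\<close>.\<close>
definition rkas_selection :: "real^'n^'m \<Rightarrow> 'w measure \<Rightarrow> (nat \<Rightarrow> 'w \<Rightarrow> 'm) \<Rightarrow> bool" where
  "rkas_selection A M I \<longleftrightarrow>
     prob_space.indep_vars M (\<lambda>_. count_space UNIV) I UNIV \<and>
     (\<forall>k i. measure M {\<omega> \<in> space M. I k \<omega> = i} = (norm (row i A))\<^sup>2 / (frobenius_norm A)\<^sup>2)"

end

theory Submission
  imports Defs
begin

text \<open>If the nonzero singular values of \<open>A\<close> all equal \<open>\<sigma>\<close>, then \<open>A\<^sup>T A\<close> acts as \<open>\<sigma>\<^sup>2\<close> on the row space
  of \<open>A\<close>.  Hence the pseudoinverse is \<open>A\<^sup>T / \<sigma>\<^sup>2\<close>, the adaptive step becomes the orthogonal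
  projection of the error onto the complement of the selected row, and averaging over the rows
  contracts the squared error by exactly \<open>1 - \<sigma>\<^sup>2 / \<parallel>A\<parallel>\<^sub>F\<^sup>2\<close>.\<close>

section \<open>Self-adjoint operators\<close>

text \<open>Moving \<open>v\<close> by \<open>t *\<^sub>R w\<close> along its eigen-residual
  \<open>w\<close> turns the gap in \<open>low\<close> into a nonnegative quadratic in
  \<open>t\<close> without constant term, so its linear coefficient
  \<open>2 * (w \<bullet> w)\<close> must vanish.\<close>

lemma rayleigh_minimizer_eigenvector:
  fixes f :: "'a::real_inner \<Rightarrow> 'a"
  assumes lin: "linear f" and sym: "\<And>x y. f x \<bullet> y = x \<bullet> f y"
    and V: "subspace V" and inv: "\<And>x. x \<in> V \<Longrightarrow> f x \<in> V"
    and low: "\<And>w. w \<in> V \<Longrightarrow> \<mu> * (w \<bullet> w) \<le> w \<bullet> f w"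
    and v: "v \<in> V" "v \<bullet> f v = \<mu> * (v \<bullet> v)"
  shows "f v = \<mu> *\<^sub>R v"
proof -
  define w where "w = f v - \<mu> *\<^sub>R v"
  have wV: "w \<in> V"
    unfolding w_def using V inv v by (intro subspace_diff subspace_scale)
  define c where "c = w \<bullet> f w - \<mu> * (w \<bullet> w)"
  have c: "c \<ge> 0" using low[OF wV] by (simp add: c_def)
  have ineq: "0 \<le> 2 * t * (w \<bullet> w) + t\<^sup>2 * c" for t
  proof -
    have f_add: "f (v + t *\<^sub>R w) = f v + t *\<^sub>R f w"
      using lin by (simp add: linear_add linear_scale)
    have "v + t *\<^sub>R w \<in> V" using V v wV by (intro subspace_add subspace_scale)
    then have "0 \<le> (v + t *\<^sub>R w) \<bullet> f (v + t *\<^sub>R w) - \<mu> * ((v + t *\<^sub>R w) \<bullet> (v + t *\<^sub>R w))"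
      using low by fastforce
    also have "\<dots> = (v \<bullet> f v - \<mu> * (v \<bullet> v)) + 2 * t * (w \<bullet> f v - \<mu> * (w \<bullet> v)) + t\<^sup>2 * c"
      using sym[of v w]
      by (simp add: f_add c_def inner_add_left inner_add_right algebra_simps power2_eq_square
          inner_commute)
    also have "w \<bullet> f v - \<mu> * (w \<bullet> v) = w \<bullet> w"
      by (simp add: w_def inner_diff_right)
    finally show ?thesis using v(2) by simp
  qed
  have "w \<bullet> w \<le> 0"
  proof (rule ccontr)
    assume "\<not> w \<bullet> w \<le> 0"
    then have p: "w \<bullet> w > 0" by (simp only: not_le)
    \<comment> \<open>Only \<open>c \<ge> 0\<close> is known, so dividing by \<open>c + 1\<close>
      avoids a zero denominator. This \<open>t\<close> makes the quadratic at most
      \<open>t * (w \<bullet> w)\<close>, which is negative.\<close>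
    define t where "t = - (w \<bullet> w) / (c + 1)"
    have "t\<^sup>2 * c \<le> t\<^sup>2 * (c + 1)" by (simp add: mult_left_mono)
    also have "\<dots> = t * (t * (c + 1))" by (simp add: power2_eq_square)
    also have "t * (c + 1) = - (w \<bullet> w)" using c by (simp add: t_def)
    finally have "0 \<le> t * (w \<bullet> w)" using ineq[of t] by simp
    moreover have "t < 0" unfolding t_def using p c by (simp add: divide_neg_pos)
    ultimately show False using p by (simp add: zero_le_mult_iff)
  qed
  then have "w = 0" by (meson inner_ge_zero inner_eq_zero_iff antisym)
  then show ?thesis by (simp add: w_def)
qed

text \<open>The Rayleigh quotient attains its minimum on the compact unit sphere of
  \<open>V\<close>, and homogeneity carries the bound to all of \<open>V\<close>. The invariant
  subspace is a parameter because both the whole space and a row space are needed.\<close>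

lemma least_eigenvector_exists:
  fixes f :: "'a::euclidean_space \<Rightarrow> 'a"
  assumes lin: "linear f" and sym: "\<And>x y. f x \<bullet> y = x \<bullet> f y"
    and V: "subspace V" and inv: "\<And>x. x \<in> V \<Longrightarrow> f x \<in> V"
    and nz: "u \<in> V" "u \<noteq> 0"
  obtains v \<mu> where "v \<in> V" "v \<noteq> 0" "f v = \<mu> *\<^sub>R v"
    "\<And>w. w \<in> V \<Longrightarrow> \<mu> * (w \<bullet> w) \<le> w \<bullet> f w"
proof -
  let ?K = "sphere 0 1 \<inter> V"
  have K: "compact ?K"
    by (intro compact_Int_closed compact_sphere closed_subspace V)
  have "(1 / norm u) *\<^sub>R u \<in> ?K" using nz V by (simp add: subspace_scale)
  then have ne: "?K \<noteq> {}" by blast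
  have "continuous_on ?K (\<lambda>x. x \<bullet> f x)"
    by (intro continuous_intros linear_continuous_on linear_conv_bounded_linear[THEN iffD1] lin)
  then obtain v where v: "v \<in> ?K" and min: "\<And>x. x \<in> ?K \<Longrightarrow> v \<bullet> f v \<le> x \<bullet> f x"
    using continuous_attains_inf[OF K ne] by blast
  define \<mu> where "\<mu> = v \<bullet> f v"
  have vv: "v \<bullet> v = 1" using v by (simp add: dot_square_norm)
  have low: "\<mu> * (w \<bullet> w) \<le> w \<bullet> f w" if "w \<in> V" for w
  proof (cases "w = 0")
    case False
    define y where "y = (1 / norm w) *\<^sub>R w"
    have "y \<in> ?K" using that False V by (simp add: y_def subspace_scale)
    then have "\<mu> \<le> y \<bullet> f y" using min \<mu>_def by blast
    also have "\<dots> = (w \<bullet> f w) / (w \<bullet> w)"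
      using lin by (simp add: y_def linear_scale dot_square_norm power2_eq_square)
    finally show ?thesis using False by (simp add: pos_le_divide_eq)
  qed simp
  have "f v = \<mu> *\<^sub>R v"
    using rayleigh_minimizer_eigenvector[OF lin sym V inv low] v vv \<mu>_def by simp
  moreover have "v \<in> V" "v \<noteq> 0" using v by auto
  ultimately show ?thesis using that low by blast
qed

text \<open>Eigenvectors for distinct eigenvalues are orthogonal, hence independent, hence finitely
  many. Finiteness is what gives \<open>Max\<close> and \<open>Min\<close> in
  \<open>sigma_max\<close> and \<open>sigma_min\<close> their meaning.\<close>

lemma finite_eigenvalues_selfadjoint:
  fixes f :: "'a::euclidean_space \<Rightarrow> 'a"
  assumes sym: "\<And>x y. f x \<bullet> y = x \<bullet> f y"
  shows "finite {l. \<exists>v. v \<noteq> 0 \<and> f v = l *\<^sub>R v}"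
proof -
  let ?E = "{l. \<exists>v. v \<noteq> 0 \<and> f v = l *\<^sub>R v}"
  define e where "e l = (SOME v. v \<noteq> 0 \<and> f v = l *\<^sub>R v)" for l
  have e: "e l \<noteq> 0" "f (e l) = l *\<^sub>R e l" if "l \<in> ?E" for l
    using that someI_ex[of "\<lambda>v. v \<noteq> 0 \<and> f v = l *\<^sub>R v"] unfolding e_def by auto
  have "inj_on e ?E"
  proof (rule inj_onI)
    fix l m assume l: "l \<in> ?E" and m: "m \<in> ?E" and eq: "e l = e m"
    have "l *\<^sub>R e l = m *\<^sub>R e l" using e(2)[OF l] e(2)[OF m] eq by metis
    then show "l = m" using e(1)[OF l] by simp
  qed
  moreover have "pairwise orthogonal (e ` ?E)"
  proof (rule pairwise_imageI)
    fix l m assume lm: "l \<in> ?E" "m \<in> ?E" "l \<noteq> m"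
    have "l * (e l \<bullet> e m) = m * (e l \<bullet> e m)"
      using sym[of "e l" "e m"] e(2)[OF lm(1)] e(2)[OF lm(2)] by simp
    then show "orthogonal (e l) (e m)" using lm(3) by (simp add: orthogonal_def)
  qed
  moreover have "0 \<notin> e ` ?E" using e(1) by (metis (no_types, lifting) imageE)
  ultimately show ?thesis
    by (intro finite_imageD[of e] independent_imp_finite pairwise_orthogonal_independent)
qed

section \<open>Matrices with equal nonzero singular values\<close>

text \<open>The largest Rayleigh quotient of A^T A on the whole space and the least one on the row
  space are both positive eigenvalues, so both equal the square of \<open>sigma_min A\<close>. The
  quotient is therefore constant on the row space.\<close>

lemma equal_singular_values:
  fixes A :: "real^'n^'m"
  assumes A: "A \<noteq> 0" and eq: "sigma_max A = sigma_min A"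
  shows "sigma_min A > 0"
    and "transpose A ** A ** transpose A = (sigma_min A)\<^sup>2 *\<^sub>R transpose A"
    and "spectral_norm A = sigma_min A"
proof -
  let ?\<sigma> = "sigma_min A"
  define f where "f x = transpose A *v (A *v x)" for x
  define V where "V = range ((*v) (transpose A))"
  have adj: "(transpose A *v z) \<bullet> x = z \<bullet> (A *v x)" for z x
    by (simp add: dot_lmul_matrix)
  have quad: "x \<bullet> f x = (norm (A *v x))\<^sup>2" for x
    unfolding f_def using adj[of "A *v x" x] by (metis inner_commute dot_square_norm)
  have sym: "f x \<bullet> y = x \<bullet> f y" for x y
    unfolding f_def using adj by (metis inner_commute)
  have "f = (*v) (transpose A) \<circ> (*v) A" by (simp add: fun_eq_iff f_def)
  then have lin: "linear f"
    by (simp only: linear_compose matrix_vector_mul_linear)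
  have SV: "singular_values A = sqrt ` {l. \<exists>v. v \<noteq> 0 \<and> f v = l *\<^sub>R v}"
    unfolding singular_values_def f_def matrix_vector_mul_assoc by blast
  have fin: "finite (singular_values A)"
    unfolding SV using finite_eigenvalues_selfadjoint sym by blast
  \<comment> \<open>The root of a positive eigenvalue is squeezed between \<open>sigma_min A\<close>
    and \<open>sigma_max A\<close>, which coincide.\<close>
  have eigen: "l = ?\<sigma>\<^sup>2" "?\<sigma> > 0" if "v \<noteq> 0" "f v = l *\<^sub>R v" "l > 0" for v l
  proof -
    have m: "sqrt l \<in> singular_values A - {0}" using that by (auto simp: SV)
    have "?\<sigma> \<le> sqrt l" unfolding sigma_min_def using m fin by (intro Min_le) auto
    moreover have "sqrt l \<le> sigma_max A"
      unfolding sigma_max_def using m fin by (intro Max_ge) auto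
    ultimately have s: "sqrt l = ?\<sigma>" using eq by simp
    show "l = ?\<sigma>\<^sup>2" using s that(3) by (metis less_imp_le real_sqrt_pow2)
    show "?\<sigma> > 0" using s that(3) by (metis real_sqrt_gt_zero)
  qed
  obtain w0 where w0: "A *v w0 \<noteq> 0"
    using A matrix_eq[of A 0] by auto

  \<comment> \<open>The largest eigenvalue of \<open>f\<close> is obtained as minus the least one of
    \<open>- f\<close>.\<close>
  have "linear (\<lambda>x. - f x)" using lin by (rule linear_compose_neg)
  moreover have "- f x \<bullet> y = x \<bullet> - f y" for x y using sym by simp
  moreover have w0_nz: "w0 \<noteq> 0" using w0 by auto
  ultimately obtain v1 \<nu> where v1: "v1 \<noteq> 0" "- f v1 = \<nu> *\<^sub>R v1"
    and low: "\<And>w. \<nu> * (w \<bullet> w) \<le> w \<bullet> - f w"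
    using least_eigenvector_exists[of "\<lambda>x. - f x" UNIV w0] by (metis UNIV_I subspace_UNIV)
  define l1 where "l1 = - \<nu>"
  have f1: "f v1 = l1 *\<^sub>R v1"
    using v1(2) by (metis l1_def minus_minus scaleR_minus_left)
  have up: "(norm (A *v w))\<^sup>2 \<le> l1 * (w \<bullet> w)" for w
    using low[of w] by (simp add: quad l1_def)
  have "0 < l1 * (w0 \<bullet> w0)" using up[of w0] w0
    by (meson less_le_trans zero_less_norm_iff zero_less_power)
  then have "l1 > 0" by (rule zero_less_mult_pos2) (simp add: w0_nz)
  note l1 = eigen[OF v1(1) f1 this]
  show pos: "?\<sigma> > 0" by (fact l1(2))

  have V: "subspace V"
    unfolding V_def by (intro linear_subspace_image matrix_vector_mul_linear subspace_UNIV)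
  have inv: "f x \<in> V" for x unfolding V_def f_def by blast
  have f0: "f w0 \<noteq> 0" using quad[of w0] w0 by auto
  obtain v2 l2 where v2: "v2 \<in> V" "v2 \<noteq> 0" "f v2 = l2 *\<^sub>R v2"
    and low2: "\<And>w. w \<in> V \<Longrightarrow> l2 * (w \<bullet> w) \<le> w \<bullet> f w"
    using least_eigenvector_exists[OF lin sym V inv inv[of w0] f0] by blast
  \<comment> \<open>Restricting to \<open>V\<close> excludes the eigenvalue 0: a vector of the row
    space killed by \<open>A\<close> is orthogonal to itself.\<close>
  have "A *v v2 \<noteq> 0"
  proof
    assume "A *v v2 = 0"
    moreover obtain z where "v2 = transpose A *v z" using v2(1) V_def by auto
    ultimately have "v2 \<bullet> v2 = 0" using adj[of z v2] by simp
    then show False using v2(2) by simp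
  qed
  then have "0 < v2 \<bullet> f v2" by (simp add: quad)
  then have "0 < l2 * (v2 \<bullet> v2)" by (simp add: v2(3))
  then have "l2 > 0" by (rule zero_less_mult_pos2) (simp add: v2(2))
  note l2 = eigen(1)[OF v2(2,3) this]
  \<comment> \<open>The bounds \<open>up\<close> and \<open>low2\<close> now agree, so every
    \<open>w\<close> in \<open>V\<close> minimizes the Rayleigh quotient and is an
    eigenvector.\<close>
  have fV: "f w = ?\<sigma>\<^sup>2 *\<^sub>R w" if "w \<in> V" for w
  proof -
    have "w \<bullet> f w = ?\<sigma>\<^sup>2 * (w \<bullet> w)"
      using up[of w] low2[OF that] l1(1) l2 by (simp add: quad)
    then show ?thesis
      using rayleigh_minimizer_eigenvector[OF lin sym V inv low2 that] l2 by simp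
  qed
  show "transpose A ** A ** transpose A = ?\<sigma>\<^sup>2 *\<^sub>R transpose A"
    unfolding matrix_eq
  proof
    fix z
    have "f (transpose A *v z) = ?\<sigma>\<^sup>2 *\<^sub>R (transpose A *v z)"
      by (rule fV) (simp add: V_def)
    then show "transpose A ** A ** transpose A *v z = ?\<sigma>\<^sup>2 *\<^sub>R transpose A *v z"
      by (simp add: f_def matrix_vector_mul_assoc matrix_mul_assoc scaleR_matrix_vector_assoc
          del: transpose_matrix_vector)
  qed

  have bl: "bounded_linear ((*v) A)" by (rule matrix_vector_mul_bounded_linear)
  have "norm (A *v x) \<le> ?\<sigma> * norm x" for x
  proof (rule power2_le_imp_le)
    show "(norm (A *v x))\<^sup>2 \<le> (?\<sigma> * norm x)\<^sup>2"
      using up[of x] l1(1) by (simp add: power_mult_distrib dot_square_norm)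
  qed (use pos in simp)
  then have "onorm ((*v) A) \<le> ?\<sigma>" by (rule onorm_le)
  \<comment> \<open>The top eigenvector \<open>v1\<close> attains the bound on the operator
    norm.\<close>
  moreover have "?\<sigma> * norm v1 \<le> onorm ((*v) A) * norm v1"
  proof -
    have "(norm (A *v v1))\<^sup>2 = (?\<sigma> * norm v1)\<^sup>2"
      using quad[of v1] f1 l1(1) by (simp add: power_mult_distrib dot_square_norm)
    then have "norm (A *v v1) = ?\<sigma> * norm v1"
      using pos by (simp add: power2_eq_iff_nonneg)
    then show ?thesis using onorm[OF bl, of v1] by simp
  qed
  ultimately show "spectral_norm A = ?\<sigma>" using v1(1) by (simp add: spectral_norm_def)
qed

section \<open>The Moore-Penrose pseudoinverse\<close>

text \<open>Both \<open>A ** P\<close> and \<open>A ** Q\<close> are the orthogonal projection onto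
  the range of \<open>A\<close>, and \<open>P ** A\<close>, \<open>Q ** A\<close> agree likewise;
  then P = PAP = QAQ = Q. This justifies the \<open>THE\<close> in \<open>pinv\<close>.\<close>

lemma is_pinv_unique:
  assumes P: "is_pinv A P" and Q: "is_pinv A Q"
  shows "P = Q"
proof -
  have p: "A ** P ** A = A" "P ** A ** P = P"
      "transpose (A ** P) = A ** P" "transpose (P ** A) = P ** A"
    and q: "A ** Q ** A = A" "Q ** A ** Q = Q"
      "transpose (A ** Q) = A ** Q" "transpose (Q ** A) = Q ** A"
    using P Q by (auto simp: is_pinv_def)
  have "A ** P = transpose ((A ** Q ** A) ** P)" using p q by simp
  also have "\<dots> = transpose (A ** P) ** transpose (A ** Q)"
    by (simp add: matrix_transpose_mul[symmetric] matrix_mul_assoc)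
  also have "\<dots> = (A ** P ** A) ** Q" using p q by (simp add: matrix_mul_assoc)
  finally have AP: "A ** P = A ** Q" using p by simp
  have "P ** A = transpose (P ** (A ** Q ** A))" using p q by simp
  also have "\<dots> = transpose (Q ** A) ** transpose (P ** A)"
    by (simp add: matrix_transpose_mul[symmetric] matrix_mul_assoc)
  also have "\<dots> = (Q ** A) ** (P ** A)" by (simp only: p q)
  also have "\<dots> = Q ** (A ** P ** A)" by (simp only: matrix_mul_assoc)
  finally have PA: "P ** A = Q ** A" using p by simp
  have "P = P ** (A ** P)" using p by (simp add: matrix_mul_assoc)
  also have "\<dots> = Q ** A ** Q" using AP PA by (simp add: matrix_mul_assoc)
  finally show ?thesis using q by simp
qed

lemma pinv_eq:
  assumes "is_pinv A P"
  shows "pinv A = P"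
  unfolding pinv_def using assms is_pinv_unique by (intro the_equality) auto

text \<open>\<open>gram\<close> and its transpose are, up to scaling, the first two Penrose
  equations; the two symmetry conditions hold for any multiple of the transpose.\<close>

lemma pinv_scaled_transpose:
  fixes A :: "real^'n^'m"
  assumes s: "s \<noteq> 0" and gram: "transpose A ** A ** transpose A = s *\<^sub>R transpose A"
  shows "pinv A = (1 / s) *\<^sub>R transpose A"
proof (rule pinv_eq)
  have "transpose (transpose A ** A ** transpose A) = transpose (s *\<^sub>R transpose A)"
    using gram by simp
  then have gram': "A ** transpose A ** A = s *\<^sub>R A"
    by (simp add: matrix_transpose_mul transpose_scalar matrix_mul_assoc)
  show "is_pinv A ((1 / s) *\<^sub>R transpose A)"
    unfolding is_pinv_def using s gram gram'
    by (simp add: matrix_transpose_mul transpose_scalar matrix_scalar_ac scalar_matrix_assoc[symmetric])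
qed

lemma frobenius_norm_sq_rows:
  fixes A :: "real^'n^'m"
  shows "(frobenius_norm A)\<^sup>2 = (\<Sum>i\<in>UNIV. (norm (row i A))\<^sup>2)"
  by (simp add: frobenius_norm_def norm_vec_def L2_set_def row_def sum_nonneg)

lemma inner_row: "row i A \<bullet> x = (A *v x) $ i" for A :: "real^'n^'m"
  by (simp add: matrix_vector_mul_component row_def)

lemma row_eq_transpose_mult: "row i A = transpose A *v axis i 1" for A :: "real^'n^'m"
  using matrix_vector_mult_basis[of "transpose A" i] by simp

section \<open>Conditioning on the current selection\<close>

text \<open>Plays the role of conditioning on the past: \<open>G\<close> sees only the selections
  before step \<open>k\<close>, which are independent of \<open>I k\<close>, so the current index
  can be averaged out first.\<close>

lemma (in prob_space) expectation_indep_step: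
  fixes I :: "nat \<Rightarrow> 'a \<Rightarrow> 'i::finite" and G :: "(nat \<Rightarrow> 'i) \<Rightarrow> 'i \<Rightarrow> real"
  assumes ind: "indep_vars (\<lambda>_. count_space UNIV) I UNIV"
    and dep: "\<And>s s' i. (\<And>j. j < k \<Longrightarrow> s j = s' j) \<Longrightarrow> G s i = G s' i"
  shows "expectation (\<lambda>\<omega>. G (\<lambda>j. I j \<omega>) (I k \<omega>))
       = expectation (\<lambda>\<omega>. \<Sum>i\<in>UNIV. prob {\<omega>\<in>space M. I k \<omega> = i} * G (\<lambda>j. I j \<omega>) i)"
proof -
  \<comment> \<open>Restriction makes the history an element of a finite product space, so
    measurability and boundedness of any function of it come for free.\<close>
  define R where "R \<omega> = restrict (\<lambda>j. I j \<omega>) {..<k}" for \<omega>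
  define R' where "R' \<omega> = restrict (\<lambda>j. I j \<omega>) {k}" for \<omega>
  let ?N = "\<lambda>B. PiM B (\<lambda>_::nat. count_space (UNIV :: 'i set))"
  have N: "?N B = count_space (PiE B (\<lambda>_. UNIV))" if "finite B" for B
    using that by (intro count_space_PiM_finite) auto
  have GR: "G (\<lambda>j. I j \<omega>) i = G (R \<omega>) i" for \<omega> i
    by (rule dep) (simp add: R_def)
  \<comment> \<open>The index blocks \<open>{..<k}\<close> and \<open>{k}\<close> are disjoint, so
    the restricted families are independent.\<close>
  have iv: "indep_var (?N {..<k}) R (?N {k}) R'"
    unfolding R_def R'_def using ind by (intro indep_var_restrict) auto
  have indep: "indep_var borel (\<lambda>\<omega>. G (R \<omega>) i) borel (\<lambda>\<omega>. of_bool (I k \<omega> = i) :: real)" for i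
  proof -
    have "indep_var borel ((\<lambda>s. G s i) \<circ> R) borel ((\<lambda>s. of_bool (s k = i) :: real) \<circ> R')"
      by (intro indep_var_compose[OF iv]) (simp_all add: N)
    then show ?thesis by (simp add: o_def R'_def)
  qed
  have intG: "integrable M (\<lambda>\<omega>. G (R \<omega>) i)" for i
  proof (rule integrable_const_bound)
    have "finite (PiE {..<k} (\<lambda>_. UNIV :: 'i set))" by (intro finite_PiE) auto
    moreover have "R \<omega> \<in> PiE {..<k} (\<lambda>_. UNIV)" for \<omega> by (simp add: R_def)
    ultimately show "AE \<omega> in M. norm (G (R \<omega>) i)
        \<le> Max ((\<lambda>s. norm (G s i)) ` PiE {..<k} (\<lambda>_. UNIV))"
      by (intro AE_I2 Max_ge) auto
    show "(\<lambda>\<omega>. G (R \<omega>) i) \<in> borel_measurable M"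
      using indep[of i] by (rule indep_var_rv1)
  qed
  have intI: "integrable M (\<lambda>\<omega>. of_bool (I k \<omega> = i) :: real)" for i
    using indep_var_rv2[OF indep[of i]] by (intro integrable_const_bound[where B = 1]) auto
  have exI: "expectation (\<lambda>\<omega>. of_bool (I k \<omega> = i) :: real) = prob {\<omega>\<in>space M. I k \<omega> = i}" for i
  proof -
    have "expectation (\<lambda>\<omega>. of_bool (I k \<omega> = i) :: real)
        = expectation (indicator {\<omega>\<in>space M. I k \<omega> = i})"
      by (intro Bochner_Integration.integral_cong) (auto simp: indicator_def)
    moreover have "{\<omega>\<in>space M. I k \<omega> = i} \<inter> space M = {\<omega>\<in>space M. I k \<omega> = i}" by blast
    ultimately show ?thesis by simp
  qed
  \<comment> \<open>Splitting over the value of \<open>I k\<close> turns each term into a product of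
    independent factors.\<close>
  have "expectation (\<lambda>\<omega>. G (\<lambda>j. I j \<omega>) (I k \<omega>))
      = expectation (\<lambda>\<omega>. \<Sum>i\<in>UNIV. G (R \<omega>) i * of_bool (I k \<omega> = i))"
    by (simp add: GR of_bool_def if_distrib[of "(*) _"] cong: if_cong)
  also have "\<dots> = (\<Sum>i\<in>UNIV. expectation (\<lambda>\<omega>. G (R \<omega>) i * of_bool (I k \<omega> = i)))"
    by (intro Bochner_Integration.integral_sum indep_var_integrable[OF indep intG intI])
  also have "\<dots> = (\<Sum>i\<in>UNIV. expectation (\<lambda>\<omega>. prob {\<omega>\<in>space M. I k \<omega> = i} * G (R \<omega>) i))"
    by (simp add: indep_var_lebesgue_integral[OF indep intG intI] exI mult.commute)
  also have "\<dots> = expectation (\<lambda>\<omega>. \<Sum>i\<in>UNIV. prob {\<omega>\<in>space M. I k \<omega> = i} * G (R \<omega>) i)"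
    by (intro Bochner_Integration.integral_sum[symmetric] integrable_mult_right intG)
  finally show ?thesis by (simp add: GR)
qed

section \<open>The iteration\<close>

lemma rkas_cong:
  "(\<And>j. j < k \<Longrightarrow> s j = s' j) \<Longrightarrow> rkas A b x0 s k = rkas A b x0 s' k"
  by (induction k) auto

text \<open>Lets the stepsize be read as a function of the iterate alone.\<close>

lemma rkas_residual: "snd (rkas A b x0 s k) = A *v rkas_x A b x0 s k - b"
  by (induction k)
    (auto simp: rkas_x_def Let_def case_prod_beta matrix_vector_mult_diff_distrib
      matrix_vector_mult_scaleR)

lemma rkas_x_Suc:
  "rkas_x A b x0 s (Suc k) = rkas_x A b x0 s k
     - rkas_alpha A (s k) (A *v rkas_x A b x0 s k - b) *\<^sub>R row (s k) A"
  using rkas_residual[of A b x0 s k] by (simp add: rkas_x_def Let_def case_prod_beta)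

text \<open>Orthogonal projection onto the complement of row \<open>i\<close>; for a zero row,
  division by 0 makes it the identity.\<close>

definition row_projection :: "real^'n^'m \<Rightarrow> 'm \<Rightarrow> real^'n \<Rightarrow> real^'n" where
  "row_projection A i e = e - ((row i A \<bullet> e) / (norm (row i A))\<^sup>2) *\<^sub>R row i A"

section \<open>Error dynamics under the Gram identity\<close>

context
  fixes A :: "real^'n^'m" and s :: real
  assumes s: "s > 0" and gram: "transpose A ** A ** transpose A = s *\<^sub>R transpose A"
begin

text \<open>On the row space \<open>A\<close> is an isometry up to the factor \<open>sqrt s\<close>.
  Only one argument has to lie there, so \<open>y\<close> may be an arbitrary iterate.\<close>

lemma inner_image_row_space: "(A *v (transpose A *v z)) \<bullet> (A *v y) = s * ((transpose A *v z) \<bullet> y)"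
proof -
  have "(A *v (transpose A *v z)) \<bullet> (A *v y) = (transpose A *v (A *v (transpose A *v z))) \<bullet> y"
    by (simp add: dot_lmul_matrix)
  also have "transpose A *v (A *v (transpose A *v z)) = s *\<^sub>R (transpose A *v z)"
    using gram by (simp add: matrix_vector_mul_assoc matrix_mul_assoc scaleR_matrix_vector_assoc
        del: transpose_matrix_vector)
  finally show ?thesis by simp
qed

lemma norm_image_row_space:
  assumes "e \<in> range ((*v) (transpose A))"
  shows "(norm (A *v e))\<^sup>2 = s * (norm e)\<^sup>2"
  using assms inner_image_row_space unfolding power2_norm_eq_inner by blast

lemma pinv_mult: "pinv A *v b = (1 / s) *\<^sub>R (transpose A *v b)"
  using pinv_scaled_transpose[OF _ gram] s
  by (simp add: scaleR_matrix_vector_assoc del: transpose_matrix_vector)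

text \<open>Numerator and denominator of the stepsize both carry the factor \<open>s\<close>, which
  cancels; what remains is the Kaczmarz projection coefficient of the error. A zero row gives 0 on
  both sides.\<close>

lemma rkas_error_Suc:
  "rkas_x A b x0 \<xi> (Suc k) - pinv A *v b = row_projection A (\<xi> k) (rkas_x A b x0 \<xi> k - pinv A *v b)"
proof -
  define a where "a = row (\<xi> k) A"
  define x where "x = rkas_x A b x0 \<xi> k"
  have a: "a = transpose A *v axis (\<xi> k) 1"
    by (simp add: a_def row_eq_transpose_mult del: transpose_matrix_vector)
  have "(A *v a) \<bullet> b = a \<bullet> (transpose A *v b)"
    using dot_lmul_matrix[of b A a] by (simp add: inner_commute)
  also have "\<dots> = s * (a \<bullet> (pinv A *v b))"
    using s by (simp add: pinv_mult del: transpose_matrix_vector)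
  finally have "(A *v a) \<bullet> (A *v x - b) = s * (a \<bullet> (x - pinv A *v b))"
    unfolding a by (simp add: inner_diff_right inner_image_row_space algebra_simps
        del: transpose_matrix_vector)
  moreover have "(norm (A *v a))\<^sup>2 = s * (norm a)\<^sup>2"
    by (rule norm_image_row_space) (simp add: a del: transpose_matrix_vector)
  ultimately have "rkas_alpha A (\<xi> k) (A *v x - b) = (a \<bullet> (x - pinv A *v b)) / (norm a)\<^sup>2"
    using s by (simp add: rkas_alpha_def a_def)
  then show ?thesis by (simp add: rkas_x_Suc row_projection_def a_def x_def)
qed

lemma row_projection_row_space:
  assumes "e \<in> range ((*v) (transpose A))"
  shows "row_projection A i e \<in> range ((*v) (transpose A))"
  unfolding row_projection_def row_eq_transpose_mult using assms
  by (intro subspace_diff subspace_scale linear_subspace_image matrix_vector_mul_linear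
      subspace_UNIV rangeI) auto

text \<open>The start at 0 matters here: the initial error is \<open>- (pinv A *v b)\<close>, a
  vector of the row space, and each projection subtracts a multiple of a row.\<close>

lemma rkas_error_row_space:
  "rkas_x A b 0 \<xi> k - pinv A *v b \<in> range ((*v) (transpose A))"
proof (induction k)
  case 0
  have "rkas_x A b 0 \<xi> 0 - pinv A *v b = (- 1 / s) *\<^sub>R (transpose A *v b)"
    by (simp add: rkas_x_def pinv_mult del: transpose_matrix_vector)
  also have "\<dots> = transpose A *v ((- 1 / s) *\<^sub>R b)"
    by (rule matrix_vector_mult_scaleR[symmetric])
  finally have "rkas_x A b 0 \<xi> 0 - pinv A *v b = transpose A *v ((- 1 / s) *\<^sub>R b)" .
  then show ?case by blast
next
  case (Suc k)
  then show ?case by (simp only: rkas_error_Suc row_projection_row_space)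
qed

text \<open>By Pythagoras row \<open>i\<close> removes the squared component of \<open>e\<close>
  along it. The weights cancel the squared row norms, so the removed parts add up to the squared
  norm of \<open>A *v e\<close>, which is \<open>s\<close> times that of \<open>e\<close>, over the
  squared Frobenius norm.\<close>

lemma mean_norm_row_projection:
  assumes A: "A \<noteq> 0" and e: "e \<in> range ((*v) (transpose A))"
  shows "(\<Sum>i\<in>UNIV. (norm (row i A))\<^sup>2 / (frobenius_norm A)\<^sup>2 * (norm (row_projection A i e))\<^sup>2)
       = (1 - s / (frobenius_norm A)\<^sup>2) * (norm e)\<^sup>2"
proof -
  let ?F = "(frobenius_norm A)\<^sup>2"
  have "?F \<noteq> 0"
  proof
    assume "?F = 0"
    then have "row i A = 0" for i by (simp add: frobenius_norm_sq_rows sum_nonneg_eq_0_iff)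
    then show False using A by (simp add: vec_eq_iff row_def)
  qed
  \<comment> \<open>Keeping the row norm as a factor avoids a division and covers zero rows.\<close>
  moreover have step: "(norm (row i A))\<^sup>2 * (norm (row_projection A i e))\<^sup>2
      = (norm (row i A))\<^sup>2 * (norm e)\<^sup>2 - ((A *v e) $ i)\<^sup>2" for i
  proof (cases "row i A = 0")
    case True
    then show ?thesis using inner_row[of i A e] by simp
  next
    case False
    define a where "a = row i A"
    have "a \<bullet> a \<noteq> 0" using False by (simp add: a_def)
    then have "(a \<bullet> a) * (row_projection A i e \<bullet> row_projection A i e) = (a \<bullet> a) * (e \<bullet> e) - (a \<bullet> e)\<^sup>2"
      unfolding row_projection_def a_def[symmetric] power2_norm_eq_inner
      by (simp add: inner_diff_left inner_diff_right inner_commute field_simps power2_eq_square)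
    then show ?thesis by (simp add: power2_norm_eq_inner a_def inner_row)
  qed
  moreover have "(\<Sum>i\<in>UNIV. ((A *v e) $ i)\<^sup>2) = s * (norm e)\<^sup>2"
    using norm_image_row_space[OF e] by (simp add: norm_vec_def L2_set_def sum_nonneg)
  moreover have "(\<Sum>i\<in>UNIV. (norm (row i A))\<^sup>2 / ?F * (norm (row_projection A i e))\<^sup>2)
      = (?F * (norm e)\<^sup>2 - (\<Sum>i\<in>UNIV. ((A *v e) $ i)\<^sup>2)) / ?F"
    by (simp add: sum_divide_distrib[symmetric] step sum_subtractf
        sum_distrib_right[symmetric] frobenius_norm_sq_rows)
  ultimately show ?thesis by (simp add: field_simps)
qed

text \<open>The one-step mean factor is the same for every error in the row space, so it leaves the
  expectation exactly and induction yields an equality.\<close>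

lemma expectation_rkas_error:
  fixes M :: "'w measure" and I :: "nat \<Rightarrow> 'w \<Rightarrow> 'm"
  assumes A: "A \<noteq> 0" and M: "prob_space M" and sel: "rkas_selection A M I"
  shows "prob_space.expectation M (\<lambda>\<omega>. (norm (rkas_x A b 0 (\<lambda>j. I j \<omega>) k - pinv A *v b))\<^sup>2)
       = (1 - s / (frobenius_norm A)\<^sup>2) ^ k * (norm (pinv A *v b))\<^sup>2"
proof (induction k)
  interpret prob_space M by (fact M)
  case 0
  show ?case by (simp add: rkas_x_def prob_space)
next
  interpret prob_space M by (fact M)
  case (Suc k)
  define err where "err \<xi> = rkas_x A b 0 \<xi> k - pinv A *v b" for \<xi>
  have "expectation (\<lambda>\<omega>. (norm (rkas_x A b 0 (\<lambda>j. I j \<omega>) (Suc k) - pinv A *v b))\<^sup>2)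
      = expectation (\<lambda>\<omega>. (norm (row_projection A (I k \<omega>) (err (\<lambda>j. I j \<omega>))))\<^sup>2)"
    by (simp add: rkas_error_Suc err_def)
  also have "\<dots> = expectation (\<lambda>\<omega>. \<Sum>i\<in>UNIV. prob {\<omega>\<in>space M. I k \<omega> = i}
      * (norm (row_projection A i (err (\<lambda>j. I j \<omega>))))\<^sup>2)"
  proof (rule expectation_indep_step)
    show "indep_vars (\<lambda>_. count_space UNIV) I UNIV" using sel by (simp add: rkas_selection_def)
    show "(norm (row_projection A i (err \<xi>)))\<^sup>2 = (norm (row_projection A i (err \<xi>')))\<^sup>2"
      if "\<And>j. j < k \<Longrightarrow> \<xi> j = \<xi>' j" for \<xi> \<xi>' i
      using rkas_cong[of k \<xi> \<xi>' A b 0] that by (simp add: err_def rkas_x_def)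
  qed
  also have "\<dots> = expectation (\<lambda>\<omega>. (1 - s / (frobenius_norm A)\<^sup>2) * (norm (err (\<lambda>j. I j \<omega>)))\<^sup>2)"
    using sel mean_norm_row_projection[OF A rkas_error_row_space]
    by (simp add: rkas_selection_def err_def)
  also have "\<dots> = (1 - s / (frobenius_norm A)\<^sup>2) ^ Suc k * (norm (pinv A *v b))\<^sup>2"
    using Suc.IH by (simp add: err_def)
  finally show ?case .
qed

end

theorem mainTheorem3:
  fixes A :: "real^'n^'m" and b :: "real^'m" and x0 :: "real^'n"
    and M :: "'w measure" and I :: "nat \<Rightarrow> 'w \<Rightarrow> 'm"
  assumes "A \<noteq> 0"
    and "sigma_max A = sigma_min A"
    and "x0 = 0"
    and "prob_space M"
    and "rkas_selection A M I"
  shows "\<forall>k.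
    prob_space.expectation M
        (\<lambda>\<omega>. (norm (A *v rkas_x A b x0 (\<lambda>j. I j \<omega>) k - A *v (pinv A *v b)))\<^sup>2)
      = (1 - sigma_min A ^ 4 / ((spectral_norm A)\<^sup>2 * (frobenius_norm A)\<^sup>2)) ^ k
          * (norm (A *v x0 - A *v (pinv A *v b)))\<^sup>2 \<and>
    prob_space.expectation M
        (\<lambda>\<omega>. (norm (rkas_x A b x0 (\<lambda>j. I j \<omega>) k - pinv A *v b))\<^sup>2)
      = inverse ((sigma_min A)\<^sup>2)
          * (1 - sigma_min A ^ 4 / ((spectral_norm A)\<^sup>2 * (frobenius_norm A)\<^sup>2)) ^ k
          * (norm (A *v x0 - A *v (pinv A *v b)))\<^sup>2"
proof
  fix k
  let ?s = "(sigma_min A)\<^sup>2"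
  let ?err = "\<lambda>\<omega>. rkas_x A b x0 (\<lambda>j. I j \<omega>) k - pinv A *v b"
  note sv = equal_singular_values[OF assms(1,2)]
  have s: "?s > 0" using sv(1) by simp
  note expect = expectation_rkas_error[OF s sv(2) assms(1,4,5), of b k]
  note image = norm_image_row_space[OF s sv(2) rkas_error_row_space[OF s sv(2)]]
  \<comment> \<open>The spectral norm equals \<open>sigma_min A\<close>, so two of the four powers
    cancel.\<close>
  have q: "sigma_min A ^ 4 / ((spectral_norm A)\<^sup>2 * (frobenius_norm A)\<^sup>2)
      = ?s / (frobenius_norm A)\<^sup>2"
    using sv(1) by (simp add: sv(3) power2_eq_square power4_eq_xxxx)
  \<comment> \<open>This is \<open>image\<close> at step 0, where the error is minus the
    pseudoinverse solution.\<close>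
  have init: "(norm (A *v x0 - A *v (pinv A *v b)))\<^sup>2 = ?s * (norm (pinv A *v b))\<^sup>2"
    using image[of b _ 0] assms(3)
    by (simp only: rkas_x_def rkas.simps fst_conv matrix_vector_mult_diff_distrib) simp
  \<comment> \<open>Residual and error differ by the constant factor \<open>?s\<close> in every
    realization, so both equalities follow from \<open>expect\<close>.\<close>
  have resid: "(norm (A *v rkas_x A b x0 (\<lambda>j. I j \<omega>) k - A *v (pinv A *v b)))\<^sup>2
      = ?s * (norm (?err \<omega>))\<^sup>2" for \<omega>
    using image assms(3) by (simp add: matrix_vector_mult_diff_distrib[symmetric])
  show "prob_space.expectation M
        (\<lambda>\<omega>. (norm (A *v rkas_x A b x0 (\<lambda>j. I j \<omega>) k - A *v (pinv A *v b)))\<^sup>2)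
      = (1 - sigma_min A ^ 4 / ((spectral_norm A)\<^sup>2 * (frobenius_norm A)\<^sup>2)) ^ k
          * (norm (A *v x0 - A *v (pinv A *v b)))\<^sup>2 \<and>
    prob_space.expectation M
        (\<lambda>\<omega>. (norm (rkas_x A b x0 (\<lambda>j. I j \<omega>) k - pinv A *v b))\<^sup>2)
      = inverse ((sigma_min A)\<^sup>2)
          * (1 - sigma_min A ^ 4 / ((spectral_norm A)\<^sup>2 * (frobenius_norm A)\<^sup>2)) ^ k
          * (norm (A *v x0 - A *v (pinv A *v b)))\<^sup>2"
    unfolding resid q init using expect s assms(3) by simp
qed

end
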